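(* For every $\epsilon>0$, there exist (unbalanced) $2$-cluster stochastic block models, i.e. a probability vector $\pi=(p,1-p)$ with $p\neq 1/2$ and a symmetric $2\times2$ matrix $M$ with non-negative entries such that $d:=\sum_j M_{ij}\pi_j>0$ does not depend on $i$, for which $d\lambda_2^2<\epsilon$ and the block model with parameters $(n,M,\pi)$ is reconstructable. Here $\lambda_2$ is the second eigenvalue (in absolute value, the first being $1$) of $T=\frac1d\operatorname{diag}(\pi)M$.
   Context: Stochastic block model $(n,M,\pi)$ with $s$ clusters: each vertex $v\in\{1,\dots,n\}$ receives an independent label $\sigma_v\in\{1,\dots,s\}$ with distribution $\pi$; conditionally on the labels, each edge $\{u,v\}$ is included independently with probability $M_{\sigma_u,\sigma_v}/n$ ($n$ large). The joint law of $(G,\sigma)$ is denoted $\mathbb{P}_n$; $M,\pi$ are fixed as $n\to\infty$. Overlap: for labellings $\sigma,\tau\in\{1,\dots,s\}^n$ let $N_i(\sigma)=\#\{v:\sigma_v=i\}$, $N_{ij}(\sigma,\tau)=\#\{v:\sigma_v=i,\tau_v=j\}$ and $$\mathrm{overlap}(\sigma,\tau)=\frac1n\max_\rho\sum_{i=1}^s\Big(N_{i\rho(i)}(\sigma,\tau)-\frac1nN_i(\sigma)N_{\rho(i)}(\tau)\Big),$$ the maximum being over all permutations $\rho$ of $\{1,\dots,s\}$. Reconstructable: there are $\delta>0$ and an algorithm $\mathcal{A}$ (a map from graphs to labellings; no computational efficiency required) such that, for $(G,\sigma)\sim\mathbb{P}_n$, $\lim_{n\to\infty}\Pr(\mathrm{overlap}(\mathcal{A}(G),\sigma)>\delta)>0$.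 *)

theory Defs
  imports
    "HOL-Probability.Probability"
    "Jordan_Normal_Form.Char_Poly"
begin

unbundle no vec_syntax

text \<open>
  Vertices are \<open>0, \<dots>, n - 1\<close> and labels are \<open>0, \<dots>, s - 1\<close>. A block model with \<open>s\<close> clusters is
  given by \<open>M\<close> and \<open>\<pi>\<close> with \<open>s = dim_vec \<pi>\<close>. A simple graph is a pair of a vertex set and a set
  of two-element edges.
\<close>

type_synonym graph = "nat set \<times> nat set set"
type_synonym labelling = "nat \<Rightarrow> nat"

definition graphs_on :: "nat \<Rightarrow> graph set" where
  "graphs_on n = {({..<n}, E) | E. E \<subseteq> {e. e \<subseteq> {..<n} \<and> card e = 2}}"

definition prob_vector :: "real vec \<Rightarrow> bool" where
  "prob_vector \<pi> \<longleftrightarrow>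
     (\<forall>i<dim_vec \<pi>. \<pi> $ i \<ge> 0) \<and> (\<Sum>i<dim_vec \<pi>. \<pi> $ i) = 1"

definition sbm_params :: "real mat \<Rightarrow> real vec \<Rightarrow> bool" where
  "sbm_params M \<pi> \<longleftrightarrow>
     prob_vector \<pi> \<and> M \<in> carrier_mat (dim_vec \<pi>) (dim_vec \<pi>) \<and> transpose_mat M = M \<and>
     (\<forall>i<dim_vec \<pi>. \<forall>j<dim_vec \<pi>. M $$ (i, j) \<ge> 0)"

definition label_pmf :: "real vec \<Rightarrow> nat pmf" where
  "label_pmf \<pi> = embed_pmf (\<lambda>i. if i < dim_vec \<pi> then \<pi> $ i else 0)"

text \<open>
  The joint law of graph and labelling. Each unordered pair of vertices is represented by the
  ordered pair \<open>(u, v)\<close> with \<open>u < v\<close>. The library's \<^const>\<open>bernoulli_pmf\<close> truncates its parameter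
  to \<open>[0, 1]\<close>, which only matters for the finitely many \<open>n\<close> below the largest entry of \<open>M\<close>.
\<close>

definition sbm :: "nat \<Rightarrow> real mat \<Rightarrow> real vec \<Rightarrow> (graph \<times> labelling) pmf" where
  "sbm n M \<pi> =
     bind_pmf (Pi_pmf {..<n} undefined (\<lambda>_. label_pmf \<pi>)) (\<lambda>\<sigma>.
       map_pmf (\<lambda>X. (({..<n}, {{u, v} | u v. X (u, v)}), \<sigma>))
         (Pi_pmf {(u, v). u < v \<and> v < n} False
           (\<lambda>(u, v). bernoulli_pmf (M $$ (\<sigma> u, \<sigma> v) / real n))))"

definition label_count :: "nat \<Rightarrow> labelling \<Rightarrow> nat \<Rightarrow> nat" where
  "label_count n \<sigma> i = card {v. v < n \<and> \<sigma> v = i}"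

definition joint_count :: "nat \<Rightarrow> labelling \<Rightarrow> labelling \<Rightarrow> nat \<Rightarrow> nat \<Rightarrow> nat" where
  "joint_count n \<sigma> \<tau> i j = card {v. v < n \<and> \<sigma> v = i \<and> \<tau> v = j}"

definition overlap :: "nat \<Rightarrow> nat \<Rightarrow> labelling \<Rightarrow> labelling \<Rightarrow> real" where
  "overlap n s \<sigma> \<tau> =
     1 / real n *
     (MAX \<rho> \<in> {\<rho>. \<rho> permutes {..<s}}.
        \<Sum>i<s. real (joint_count n \<sigma> \<tau> i (\<rho> i)) -
             1 / real n * real (label_count n \<sigma> i) * real (label_count n \<tau> (\<rho> i)))"

definition reconstructable :: "real mat \<Rightarrow> real vec \<Rightarrow> bool" where
  "reconstructable M \<pi> \<longleftrightarrow>
     (\<exists>\<delta>>0. \<exists>A :: graph \<Rightarrow> labelling.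
        (\<forall>n. \<forall>G\<in>graphs_on n. A G \<in> {..<n} \<rightarrow> {..<dim_vec \<pi>}) \<and>
        (\<exists>L>0. (\<lambda>n. measure_pmf.prob (sbm n M \<pi>)
                  {(G, \<sigma>). overlap n (dim_vec \<pi>) (A G) \<sigma> > \<delta>}) \<longlonglongrightarrow> L))"

definition transition_mat :: "real \<Rightarrow> real mat \<Rightarrow> real vec \<Rightarrow> real mat" where
  "transition_mat d M \<pi> = (1 / d) \<cdot>\<^sub>m (mat_diag (dim_vec \<pi>) (\<lambda>i. \<pi> $ i) * M)"

text \<open>
  The eigenvalues of \<open>T\<close>, counted with algebraic multiplicity, are \<open>1, l, xs\<close> in order of
  decreasing absolute value up to reordering within \<open>xs\<close>. All of them are real for \<open>T\<close> as above, since
  \<open>diag(\<pi>) M\<close> has the same characteristic polynomial as the symmetric matrix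
  \<open>diag(\<pi>)\<^sup>1\<^sup>/\<^sup>2 M diag(\<pi>)\<^sup>1\<^sup>/\<^sup>2\<close>. This is a relation because \<open>l\<close> is in general only determined
  up to sign when \<open>l\<close> and \<open>-l\<close> are both eigenvalues.
\<close>

definition second_eigenvalue :: "real mat \<Rightarrow> real \<Rightarrow> bool" where
  "second_eigenvalue T l \<longleftrightarrow>
     (\<exists>xs. char_poly T = (\<Prod>a\<leftarrow>1 # l # xs. [:- a, 1:]) \<and>
           \<bar>l\<bar> \<le> 1 \<and> (\<forall>a\<in>set xs. \<bar>a\<bar> \<le> \<bar>l\<bar>))"

end

theory Submission
  imports Defs "HOL-Real_Asymp.Real_Asymp"
begin

text \<open>
  Plant an independent set: \<open>M\<^sub>1\<^sub>1 = 0\<close> and \<open>p\<close> small. Equal expected degrees force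
  \<open>\<lambda>\<^sub>2 = - p / (1 - p)\<close>, so \<open>d \<lambda>\<^sub>2\<^sup>2\<close> is of order \<open>d p\<^sup>2\<close>. A first moment computation shows that the
  second cluster, an Erdos-Renyi graph of average degree of order \<open>d\<close>, has with high probability no
  independent set of size \<open>\<kappa> n\<close> once \<open>d \<kappa>\<close> exceeds a multiple of \<open>ln (1 / \<kappa>)\<close>. With \<open>p = 4 \<kappa>\<close>, a maximum
  independent set therefore lies mostly inside the planted one, and labelling it \<open>0\<close> reconstructs.
  The choice \<open>\<kappa> = t\<^sup>2\<close>, \<open>d = 1 / t\<^sup>3\<close> with \<open>t\<close> tending to \<open>0\<close> satisfies the density condition, while
  \<open>d p\<^sup>2 = 16 t\<close> vanishes.
\<close>

section \<open>Counting and tail estimates\<close>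

text \<open>The left side is a single term of the binomial expansion of \<open>(1 + x) ^ n\<close>,
  and \<open>1 + x \<le> exp x\<close>. Dividing by \<open>x ^ k\<close> bounds the number of
  candidate sets in the union bound.\<close>

lemma choose_mult_power_le_exp:
  fixes x :: real
  assumes "x \<ge> 0"
  shows "real (n choose k) * x ^ k \<le> exp (real n * x)"
proof (cases "k \<le> n")
  case True
  have "real (n choose k) * x ^ k \<le> (\<Sum>j\<le>n. real (n choose j) * x ^ j)"
    using assms True by (intro member_le_sum) auto
  also have "\<dots> = (1 + x) ^ n"
    using binomial_ring[of x 1 n] by (simp add: add.commute)
  also have "\<dots> \<le> exp x ^ n"
    using assms by (intro power_mono) (auto simp: exp_ge_add_one_self)
  also have "\<dots> = exp (real n * x)"
    by (simp add: exp_of_nat_mult)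
  finally show ?thesis .
qed (simp add: binomial_eq_0)

text \<open>Forgetting the order is a bijection onto the two-element subsets of \<open>S\<close>.
  This counts the edge variables that must vanish for \<open>S\<close> to be independent.\<close>

lemma card_increasing_pairs:
  fixes S :: "'a :: linorder set"
  assumes "finite S"
  shows "card {(u, v). u \<in> S \<and> v \<in> S \<and> u < v} = card S choose 2"
proof -
  let ?P = "{(u, v). u \<in> S \<and> v \<in> S \<and> u < v}"
  have "e \<in> (\<lambda>(u, v). {u, v}) ` ?P" if e: "e \<subseteq> S" "card e = 2" for e
  proof -
    obtain a b where ab: "e = {a, b}" "a \<noteq> b"
      using e(2) by (auto simp: card_2_iff)
    then have "(min a b, max a b) \<in> ?P" "e = {min a b, max a b}"
      using e(1) by (auto simp: min_def max_def)
    then show ?thesis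
      by (metis (mono_tags, lifting) case_prod_conv image_eqI)
  qed
  moreover have "(\<lambda>(u, v). {u, v}) ` ?P \<subseteq> {e. e \<subseteq> S \<and> card e = 2}"
    by auto
  ultimately have image: "(\<lambda>(u, v). {u, v}) ` ?P = {e. e \<subseteq> S \<and> card e = 2}"
    by blast
  have "inj_on (\<lambda>(u, v). {u, v}) ?P"
    by (auto simp: inj_on_def doubleton_eq_iff)
  from card_image[OF this] show ?thesis
    unfolding image n_subsets[OF assms] by (rule sym)
qed

lemma prob_Pi_pmf_all_False:
  assumes "finite A" "B \<subseteq> A" "0 \<le> q" "q \<le> 1"
    and "\<And>e. e \<in> B \<Longrightarrow> p e = bernoulli_pmf q"
  shows "measure_pmf.prob (Pi_pmf A dflt p) {X. \<forall>e\<in>B. \<not> X e} = (1 - q) ^ card B"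
proof -
  \<comment> \<open>The event constrains only the coordinates in \<open>B\<close>, so it is a
    product set and its probability factorises.\<close>
  have "{X. \<forall>e\<in>B. \<not> X e} = Pi A (\<lambda>e. if e \<in> B then {False} else UNIV)"
    using assms(2) by (auto simp: Pi_def split: if_splits)
  then have "measure_pmf.prob (Pi_pmf A dflt p) {X. \<forall>e\<in>B. \<not> X e} =
      (\<Prod>e\<in>A. measure_pmf.prob (p e) (if e \<in> B then {False} else UNIV))"
    using assms(1) by (simp add: measure_Pi_pmf_Pi)
  also have "\<dots> = (\<Prod>e\<in>A. if e \<in> B then 1 - q else 1)"
    using assms(3-5) by (intro prod.cong) (auto simp: measure_pmf_single)
  also have "\<dots> = (1 - q) ^ card B"
    using assms(1,2) by (simp add: prod.If_cases Int_absorb1)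
  finally show ?thesis .
qed

text \<open>Conditioning on the first stage: outcomes in the exceptional set \<open>S\<close> are
  charged in full, all others at most \<open>b\<close>. Below, \<open>p\<close> is the law of the
  labels and \<open>f\<close> that of the graph given the labels.\<close>

lemma prob_bind_pmf_le:
  assumes "measure_pmf.prob p S \<le> a" "b \<ge> 0"
    and "\<And>x. x \<in> set_pmf p \<Longrightarrow> x \<notin> S \<Longrightarrow> measure_pmf.prob (f x) B \<le> b"
  shows "measure_pmf.prob (bind_pmf p f) B \<le> a + b"
proof -
  have a: "a \<ge> 0"
    using assms(1) measure_nonneg order_trans by blast
  have "emeasure (bind_pmf p f) B = (\<integral>\<^sup>+x. emeasure (f x) B \<partial>p)"
    by simp
  also have "\<dots> \<le> (\<integral>\<^sup>+x. indicator S x + ennreal b \<partial>p)"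
  proof (intro nn_integral_mono_AE AE_pmfI)
    fix x assume "x \<in> set_pmf p"
    then show "emeasure (f x) B \<le> indicator S x + ennreal b"
      using assms(2) assms(3)[of x] measure_pmf.prob_le_1[of "f x" B]
      by (cases "x \<in> S")
        (auto simp: measure_pmf.emeasure_eq_measure ennreal_leI add_increasing2)
  qed
  also have "\<dots> = emeasure p S + ennreal b"
    by (subst nn_integral_add) auto
  also have "\<dots> \<le> ennreal (a + b)"
    using assms(1,2) a by (simp add: measure_pmf.emeasure_eq_measure ennreal_leI flip: ennreal_plus)
  finally show ?thesis
    using a assms(2)
    by (simp add: measure_pmf.emeasure_eq_measure ennreal_le_iff del: ennreal_plus)
qed

section \<open>Reconstruction by a maximum independent set\<close>

definition independent_set :: "graph \<Rightarrow> nat set \<Rightarrow> bool" where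
  "independent_set G S \<longleftrightarrow>
     S \<subseteq> fst G \<and> (\<forall>u\<in>S. \<forall>v\<in>S. u \<noteq> v \<longrightarrow> {u, v} \<notin> snd G)"

text \<open>Ties between sets of equal size are broken by the choice inside \<open>arg_max\<close>,
  so this is a deterministic function of the graph.\<close>

definition max_independent_set :: "graph \<Rightarrow> nat set" where
  "max_independent_set G = arg_max card (independent_set G)"

definition independent_labelling :: "graph \<Rightarrow> labelling" where
  "independent_labelling G v = (if v \<in> max_independent_set G then 0 else 1)"

lemma max_independent_set:
  assumes "finite (fst G)"
  shows "independent_set G (max_independent_set G)"
    and "independent_set G S \<Longrightarrow> card S \<le> card (max_independent_set G)"
proof -
  have "independent_set G {}"
    by (simp add: independent_set_def)
  moreover have "\<forall>S. independent_set G S \<longrightarrow> card S < Suc (card (fst G))"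
    using assms by (auto simp: independent_set_def less_Suc_eq_le intro: card_mono)
  ultimately have *: "independent_set G (arg_max card (independent_set G)) \<and>
      (\<forall>S. independent_set G S \<longrightarrow> card S \<le> card (arg_max card (independent_set G)))"
    by (rule arg_max_nat_lemma)
  show "independent_set G (max_independent_set G)"
    "independent_set G S \<Longrightarrow> card S \<le> card (max_independent_set G)"
    using * by (auto simp: max_independent_set_def)
qed

text \<open>The identity permutation competes in the maximum. With two labels, the class sizes and
  the \<open>(0, 0)\<close> count determine all other counts, and the summands for
  \<open>i = 0\<close> and \<open>i = 1\<close> are equal, hence the factor 2.\<close>

lemma overlap_2_ge:
  assumes "n > 0" "\<And>v. v < n \<Longrightarrow> \<sigma> v < 2" "\<And>v. v < n \<Longrightarrow> \<tau> v < 2"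
  shows "overlap n 2 \<sigma> \<tau> \<ge>
    2 / n * (joint_count n \<sigma> \<tau> 0 0 - real (label_count n \<sigma> 0) * real (label_count n \<tau> 0) / n)"
proof -
  define f where "f = (\<lambda>\<rho>. \<Sum>i<2. real (joint_count n \<sigma> \<tau> i (\<rho> i)) -
             1 / real n * real (label_count n \<sigma> i) * real (label_count n \<tau> (\<rho> i)))"
  define a where "a = real (label_count n \<sigma> 0)"
  define b where "b = real (label_count n \<tau> 0)"
  define c where "c = real (joint_count n \<sigma> \<tau> 0 0)"
  let ?S = "{v. v < n \<and> \<sigma> v = 0}" and ?T = "{v. v < n \<and> \<tau> v = 0}"
  have fin: "finite ?S" "finite ?T" by auto
  have one: "x = Suc 0 \<longleftrightarrow> x \<noteq> 0" if "x < 2" for x :: nat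
    using that by auto
  have compl: "real (card ({..<n} - X)) = n - real (card X)" if "X \<subseteq> {..<n}" for X
    using card_mono[OF _ that] finite_subset[OF that] that
    by (simp add: card_Diff_subset of_nat_diff)
  have "{v. v < n \<and> \<sigma> v = 1} = {..<n} - ?S"
    using assms(2) one by auto
  then have a1: "real (label_count n \<sigma> 1) = n - a"
    using compl[of ?S] by (auto simp: label_count_def a_def)
  have "{v. v < n \<and> \<tau> v = 1} = {..<n} - ?T"
    using assms(3) one by auto
  then have b1: "real (label_count n \<tau> 1) = n - b"
    using compl[of ?T] by (auto simp: label_count_def b_def)
  \<comment> \<open>Inclusion-exclusion for the vertices that carry label 1 in both
    labellings.\<close>
  have "?S \<inter> ?T = {v. v < n \<and> \<sigma> v = 0 \<and> \<tau> v = 0}"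
    by auto
  then have "real (card (?S \<union> ?T)) = a + b - c"
    using card_Un_Int[OF fin] unfolding a_def b_def c_def label_count_def joint_count_def
    by simp
  moreover have "real (card ({..<n} - (?S \<union> ?T))) = n - real (card (?S \<union> ?T))"
    by (rule compl) auto
  moreover have "{v. v < n \<and> \<sigma> v = 1 \<and> \<tau> v = 1} = {..<n} - (?S \<union> ?T)"
    using assms(2,3) one by auto
  then have "real (joint_count n \<sigma> \<tau> 1 1) = real (card ({..<n} - (?S \<union> ?T)))"
    by (simp only: joint_count_def)
  ultimately have c1: "real (joint_count n \<sigma> \<tau> 1 1) = n - a - b + c"
    by linarith
  have "f id = c - 1 / n * a * b + (n - a - b + c - 1 / n * (n - a) * (n - b))"
    using a1 b1 c1 by (simp add: f_def numeral_2_eq_2 a_def b_def c_def)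
  also have "\<dots> = 2 * (c - a * b / n)"
    using assms(1) by (simp add: field_simps)
  finally have "f id = 2 * (c - a * b / n)" .
  moreover have "f id \<le> Max (f ` {\<rho>. \<rho> permutes {..<2}})"
    by (intro Max_ge) (auto simp: finite_permutations permutes_id)
  ultimately have "1 / n * (2 * (c - a * b / n)) \<le> overlap n 2 \<sigma> \<tau>"
    unfolding overlap_def f_def by (intro mult_left_mono) auto
  then show ?thesis
    by (simp add: a_def b_def c_def)
qed

text \<open>
  Only a lower bound on the size of the maximum independent set is needed, and the planted one, the
  label class \<open>0\<close>, provides it.
\<close>

lemma overlap_independent_labelling:
  fixes \<kappa> :: real
  assumes "n > 0" "fst G = {..<n}" "\<And>v. v < n \<Longrightarrow> \<sigma> v < 2"
    and planted: "independent_set G {v. v < n \<and> \<sigma> v = 0}"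
    and few: "\<And>S. independent_set G S \<Longrightarrow> real (card (S \<inter> {v. \<sigma> v = 1})) \<le> \<kappa> * n"
    and count: "3 * \<kappa> < label_count n \<sigma> 0 / n" "label_count n \<sigma> 0 / n < 5 * \<kappa>"
    and "0 < \<kappa>" "5 * \<kappa> \<le> 1 / 2"
  shows "overlap n 2 (independent_labelling G) \<sigma> > \<kappa> / 2"
proof -
  define S where "S = max_independent_set G"
  define a where "a = real (card S)"
  define b where "b = real (label_count n \<sigma> 0)"
  define c where "c = real (joint_count n (independent_labelling G) \<sigma> 0 0)"
  have S: "independent_set G S" and ba: "b \<le> a"
    using max_independent_set[of G] planted assms(2)
    by (auto simp: S_def a_def b_def label_count_def)
  have Sn: "S \<subseteq> {..<n}"
    using S assms(2) by (simp add: independent_set_def)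
  then have [simp]: "finite S"
    using finite_subset by blast
  have lab: "label_count n (independent_labelling G) 0 = card S"
    unfolding label_count_def independent_labelling_def using Sn
    by (intro arg_cong[of _ _ card]) (auto simp: S_def)
  \<comment> \<open>Deleting class 1 from \<open>S\<close> leaves exactly the vertices labelled 0 by
    both labellings, and \<open>few\<close> limits the loss to \<open>\<kappa> * n\<close>.\<close>
  have "c = card (S - S \<inter> {v. \<sigma> v = 1})"
    unfolding c_def joint_count_def independent_labelling_def using Sn assms(3)
    by (intro arg_cong[of _ _ real] arg_cong[of _ _ card])
      (fastforce simp: S_def less_2_cases_iff split: if_splits)
  then have c: "c \<ge> a - \<kappa> * n"
    using few[OF S] by (simp add: a_def card_Diff_subset of_nat_diff card_mono)
  define \<beta> where "\<beta> = b / n"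
  have \<beta>: "3 * \<kappa> < \<beta>" "\<beta> < 5 * \<kappa>" and b: "b = \<beta> * n"
    using count assms(1) by (auto simp: \<beta>_def b_def)
  \<comment> \<open>Since \<open>\<beta> < 1 / 2\<close>, the product
    \<open>\<beta> * (1 - \<beta>)\<close> is at least
    \<open>\<beta> / 2 > 3 * \<kappa> / 2\<close>; subtracting the loss \<open>\<kappa>\<close>
    leaves more than \<open>\<kappa> / 2\<close>.\<close>
  have "n * (\<kappa> / 2) < n * (\<beta> * (1 - \<beta>) - \<kappa>)"
  proof -
    have "\<beta> * (1 / 2) \<le> \<beta> * (1 - \<beta>)"
      using \<beta> assms(8,9) by (intro mult_left_mono) auto
    then have "\<kappa> / 2 < \<beta> * (1 - \<beta>) - \<kappa>"
      using \<beta> by linarith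
    then show ?thesis
      using assms(1) by (intro mult_strict_left_mono) auto
  qed
  also have "\<dots> = b * (1 - \<beta>) - \<kappa> * n"
    by (simp add: b algebra_simps)
  \<comment> \<open>Maximality enters here: \<open>S\<close> is at least as large as the planted
    set.\<close>
  also have "\<dots> \<le> a * (1 - \<beta>) - \<kappa> * n"
    using ba \<beta> assms(8,9) by (intro diff_right_mono mult_right_mono) auto
  also have "\<dots> \<le> c - a * b / n"
    using c by (simp add: \<beta>_def algebra_simps)
  finally have "2 / n * (n * (\<kappa> / 2)) < 2 / n * (c - a * b / n)"
    using assms(1) by (intro mult_strict_left_mono) auto
  also have "\<dots> \<le> overlap n 2 (independent_labelling G) \<sigma>"
    using overlap_2_ge[of n "independent_labelling G" \<sigma>] assms(1,3) lab
    by (simp add: a_def b_def c_def independent_labelling_def)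
  finally show ?thesis
    using assms(1,8) by simp
qed

section \<open>First moment bound for independent sets within one label class\<close>

text \<open>The inner stage of \<open>sbm\<close>: the conditional law of the edge indicators given
  the labels.\<close>

definition edge_pmf :: "nat \<Rightarrow> real mat \<Rightarrow> labelling \<Rightarrow> (nat \<times> nat \<Rightarrow> bool) pmf" where
  "edge_pmf n M \<sigma> = Pi_pmf {(u, v). u < v \<and> v < n} False
     (\<lambda>(u, v). bernoulli_pmf (M $$ (\<sigma> u, \<sigma> v) / real n))"

lemma finite_vertex_pairs: "finite {(u, v). u < v \<and> v < (n :: nat)}"
  by (rule finite_subset[of _ "{..<n} \<times> {..<n}"]) auto

text \<open>Union bound over the \<open>k\<close>-subsets of one class. Within a class all pairs
  have the same edge probability, and the hypotheses keep it in \<open>[0, 1]\<close>, so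
  \<open>bernoulli_pmf\<close> does not truncate it.\<close>

lemma prob_class_independent_le:
  assumes "0 \<le> M $$ (i, i)" "M $$ (i, i) \<le> real n"
  shows "measure_pmf.prob (edge_pmf n M \<sigma>)
      {X. \<exists>S. S \<subseteq> {v. v < n \<and> \<sigma> v = i} \<and> card S = k \<and>
            (\<forall>u\<in>S. \<forall>v\<in>S. u < v \<longrightarrow> \<not> X (u, v))}
    \<le> real (n choose k) * (1 - M $$ (i, i) / n) ^ (k choose 2)"
proof -
  define \<S> where "\<S> = {S. S \<subseteq> {v. v < n \<and> \<sigma> v = i} \<and> card S = k}"
  define q where "q = M $$ (i, i) / n"
  have q: "0 \<le> q" "q \<le> 1"
    using assms by (auto simp: q_def divide_le_eq_1)
  define P where "P = (\<lambda>S. {(u, v). u \<in> S \<and> v \<in> S \<and> u < (v :: nat)})"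
  have sub: "\<S> \<subseteq> {S. S \<subseteq> {..<n} \<and> card S = k}"
    by (auto simp: \<S>_def)
  have fin: "finite \<S>"
    by (rule finite_subset[OF sub]) simp
  have card: "card \<S> \<le> n choose k"
    using card_mono[OF _ sub] n_subsets[of "{..<n}" k] by simp
  have prob: "measure_pmf.prob (edge_pmf n M \<sigma>) {X. \<forall>e\<in>P S. \<not> X e} = (1 - q) ^ (k choose 2)"
    if "S \<in> \<S>" for S
  proof -
    have "finite S"
      using that by (auto simp: \<S>_def intro: finite_subset)
    then have "card (P S) = k choose 2"
      using that card_increasing_pairs[of S] by (simp add: \<S>_def P_def)
    moreover have "v < n \<and> \<sigma> v = i" if "v \<in> S" for v
      using \<open>S \<in> \<S>\<close> that by (auto simp: \<S>_def)
    then have "measure_pmf.prob (edge_pmf n M \<sigma>) {X. \<forall>e\<in>P S. \<not> X e} = (1 - q) ^ card (P S)"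
      unfolding edge_pmf_def
      by (intro prob_Pi_pmf_all_False finite_vertex_pairs q) (auto simp: P_def q_def)
    ultimately show ?thesis by simp
  qed
  have "measure_pmf.prob (edge_pmf n M \<sigma>) (\<Union>S\<in>\<S>. {X. \<forall>e\<in>P S. \<not> X e})
      \<le> (\<Sum>S\<in>\<S>. measure_pmf.prob (edge_pmf n M \<sigma>) {X. \<forall>e\<in>P S. \<not> X e})"
    using fin by (intro measure_pmf.finite_measure_subadditive_finite) auto
  also have "\<dots> = card \<S> * (1 - q) ^ (k choose 2)"
    by (simp add: prob)
  also have "\<dots> \<le> real (n choose k) * (1 - q) ^ (k choose 2)"
    using card q by (intro mult_right_mono) auto
  also have "(\<Union>S\<in>\<S>. {X. \<forall>e\<in>P S. \<not> X e}) =
      {X. \<exists>S. S \<subseteq> {v. v < n \<and> \<sigma> v = i} \<and> card S = k \<and>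
            (\<forall>u\<in>S. \<forall>v\<in>S. u < v \<longrightarrow> \<not> X (u, v))}"
    by (auto simp: \<S>_def P_def)
  finally show ?thesis
    by (simp add: q_def)
qed

text \<open>Both factors are bounded by exponentials of multiples of \<open>k\<close>: the binomial
  coefficient contributes at most \<open>1 - ln \<kappa>\<close> per vertex, the missing edges at
  most \<open>1 / 2 - c * \<kappa> / 2\<close>. The constant \<open>5 / 2\<close> makes the total at
  most \<open>-1\<close>.\<close>

lemma choose_mult_power_choose_2_le:
  fixes c \<kappa> :: real
  assumes "0 < n" "0 \<le> c" "c \<le> n" "0 < \<kappa>" "\<kappa> * n \<le> k"
    and dense: "c * \<kappa> / 2 \<ge> 5 / 2 - ln \<kappa>"
  shows "real (n choose k) * (1 - c / n) ^ (k choose 2) \<le> exp (- \<kappa> * n)"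
proof -
  define m where "m = k choose 2"
  have m: "real m = real k * (real k - 1) / 2"
    unfolding m_def by (cases k) (auto simp: choose_two real_of_nat_div field_simps)
  have "real (n choose k) * \<kappa> ^ k \<le> exp (\<kappa> * n)"
    using choose_mult_power_le_exp[of \<kappa> n k] assms by (simp add: mult.commute)
  also have "\<dots> \<le> exp k"
    using assms by simp
  finally have "real (n choose k) \<le> exp k / \<kappa> ^ k"
    using assms by (simp add: field_simps)
  also have "\<dots> = exp (k * (1 - ln \<kappa>))"
    using assms by (simp add: algebra_simps exp_diff exp_of_nat_mult)
  finally have 1: "real (n choose k) \<le> exp (k * (1 - ln \<kappa>))" .
  have "(1 - c / n) ^ m \<le> exp (- c / n) ^ m"
    using assms exp_ge_add_one_self[of "- c / n"] by (intro power_mono) auto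
  also have "\<dots> = exp (- (k * (c * (real k - 1) / (2 * n))))"
    by (simp add: m exp_of_nat_mult[symmetric])
  finally have 2: "(1 - c / n) ^ m \<le> exp (- (k * (c * (real k - 1) / (2 * n))))" .
  \<comment> \<open>Having \<open>k - 1\<close> instead of \<open>k\<close> costs
    \<open>c / (2 * n)\<close>, which is at most \<open>1 / 2\<close> because
    \<open>c \<le> n\<close>.\<close>
  have "c * \<kappa> / 2 - 1 / 2 \<le> c * (real k - 1) / (2 * n)"
  proof -
    have "c * (\<kappa> * n) \<le> c * k"
      using assms by (intro mult_left_mono) auto
    then show ?thesis
      using assms(1,3) by (simp add: field_simps)
  qed
  then have "1 - ln \<kappa> - c * (real k - 1) / (2 * n) \<le> - 1"
    using dense by linarith
  then have "k * (1 - ln \<kappa> - c * (real k - 1) / (2 * n)) \<le> real k * (- 1)"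
    by (intro mult_left_mono) auto
  then have 3: "k * (1 - ln \<kappa>) + - (k * (c * (real k - 1) / (2 * n))) \<le> - k"
    by (simp add: algebra_simps)
  have "real (n choose k) * (1 - c / n) ^ m \<le>
      exp (k * (1 - ln \<kappa>)) * exp (- (k * (c * (real k - 1) / (2 * n))))"
    using 1 2 assms by (intro mult_mono) auto
  also have "\<dots> \<le> exp (- real k)"
    using 3 by (simp flip: exp_add)
  also have "\<dots> \<le> exp (- \<kappa> * n)"
    using assms by simp
  finally show ?thesis
    by (simp add: m_def)
qed

section \<open>The two-cluster model with a planted independent set\<close>

text \<open>Evaluating \<open>embed_pmf\<close> requires checking that the total mass is 1. The
  Bernoulli form makes the size of class 0 binomial.\<close>

lemma label_pmf_two:
  assumes "0 \<le> p" "p \<le> 1"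
  shows "map_pmf (\<lambda>i. i = 0) (label_pmf (vec_of_list [p, 1 - p])) = bernoulli_pmf p"
    and "set_pmf (label_pmf (vec_of_list [p, 1 - p])) \<subseteq> {0, 1}"
proof -
  define f where "f = (\<lambda>i :: nat. if i < 2 then vec_of_list [p, 1 - p] $ i else 0)"
  have f: "f i = (if i = 0 then p else if i = 1 then 1 - p else 0)" for i
    by (auto simp: f_def less_2_cases_iff)
  have "(\<integral>\<^sup>+ i. ennreal (f i) \<partial>count_space UNIV) = (\<Sum>i\<in>{0, 1}. ennreal (f i))"
    by (subst nn_integral_count_space'[of "{0, 1}"]) (auto simp: f)
  also have "\<dots> = 1"
    using assms by (simp add: f flip: ennreal_plus)
  finally have int: "(\<integral>\<^sup>+ i. ennreal (f i) \<partial>count_space UNIV) = 1" .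
  have nonneg: "f i \<ge> 0" for i
    using assms by (simp add: f)
  have "dim_vec (vec_of_list [p, 1 - p]) = 2"
    by simp
  then have lab: "label_pmf (vec_of_list [p, 1 - p]) = embed_pmf f"
    by (simp only: label_pmf_def f_def)
  have pmf: "pmf (embed_pmf f) i = f i" for i
    using nonneg int by (rule pmf_embed_pmf)
  have set: "set_pmf (embed_pmf f) = {i. f i \<noteq> 0}"
    using nonneg int by (rule set_embed_pmf)
  show "set_pmf (label_pmf (vec_of_list [p, 1 - p])) \<subseteq> {0, 1}"
    unfolding lab set by (auto simp: f split: if_splits)
  have True: "pmf (map_pmf (\<lambda>i. i = 0) (embed_pmf f)) True = p"
  proof -
    have "(\<lambda>i :: nat. i = 0) -` {True} = {0}" by auto
    then show ?thesis
      by (simp add: pmf_map measure_pmf_single pmf f)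
  qed
  show "map_pmf (\<lambda>i. i = 0) (label_pmf (vec_of_list [p, 1 - p])) = bernoulli_pmf p"
  proof (rule pmf_eqI)
    fix b
    show "pmf (map_pmf (\<lambda>i. i = 0) (label_pmf (vec_of_list [p, 1 - p]))) b = pmf (bernoulli_pmf p) b"
      unfolding lab using True assms by (cases b) (simp_all add: pmf_False_conv_True)
  qed
qed

text \<open>Hoeffding's inequality for the binomial distribution, transported to the size of class
  0.\<close>

lemma prob_label_count_deviation:
  assumes "0 \<le> p" "p \<le> 1" "n > 0" "\<eta> \<ge> 0"
  shows "measure_pmf.prob (Pi_pmf {..<n} undefined (\<lambda>_. label_pmf (vec_of_list [p, 1 - p])))
      {\<sigma>. \<bar>label_count n \<sigma> 0 / n - p\<bar> \<ge> \<eta>} \<le> 2 * exp (- 2 * real n * \<eta>\<^sup>2)"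
proof -
  interpret binomial_distribution n p
    using assms by unfold_locales auto
  let ?P = "Pi_pmf {..<n} undefined (\<lambda>_. label_pmf (vec_of_list [p, 1 - p]))"
  \<comment> \<open>The default \<open>undefined = 0\<close> is the image of the default label
    \<open>undefined\<close> under \<open>\<lambda>i. i = 0\<close>, as \<open>Pi_pmf_map\<close>
    requires. Only vertices below \<open>n\<close> are counted, so its value does not
    matter.\<close>
  have "binomial_pmf n p = map_pmf (\<lambda>f. card {v \<in> {..<n}. f v})
      (Pi_pmf {..<n} (undefined = (0 :: nat)) (\<lambda>_. bernoulli_pmf p))"
    using assms by (intro binomial_pmf_altdef') auto
  also have "\<dots> = map_pmf (\<lambda>\<sigma>. label_count n \<sigma> 0) ?P"
    unfolding label_pmf_two(1)[OF assms(1,2), symmetric]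
    by (subst Pi_pmf_map[where dflt = undefined])
      (simp_all add: map_pmf_comp label_count_def)
  finally have "measure_pmf.prob ?P {\<sigma>. \<bar>label_count n \<sigma> 0 / n - p\<bar> \<ge> \<eta>} =
      measure_pmf.prob (binomial_pmf n p) {x. \<bar>x / n - p\<bar> \<ge> \<eta>}"
    by simp
  also have "\<dots> \<le> 2 * exp (- 2 * real n * \<eta>\<^sup>2)"
    using prob_abs_ge'[of \<eta>] assms by simp
  finally show ?thesis .
qed

text \<open>Two failures are possible: class 0 has a proportion off \<open>4 * \<kappa>\<close> by
  at least \<open>\<kappa>\<close>, or class 1 contains an independent set of size about
  \<open>\<kappa> * n\<close>. Concentration bounds the first, the first moment the second;
  otherwise the deterministic overlap estimate applies.\<close>

lemma prob_overlap_independent_labelling: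
  fixes \<kappa> :: real and M :: "real mat"
  defines "\<pi> \<equiv> vec_of_list [4 * \<kappa>, 1 - 4 * \<kappa>]" and "c \<equiv> M $$ (1, 1)"
  assumes "n > 0" "0 < \<kappa>" "5 * \<kappa> \<le> 1 / 2" "M $$ (0, 0) = 0" "0 \<le> c" "c \<le> n"
    and dense: "c * \<kappa> / 2 \<ge> 5 / 2 - ln \<kappa>"
  shows "measure_pmf.prob (sbm n M \<pi>)
      {(G, \<sigma>). overlap n 2 (independent_labelling G) \<sigma> > \<kappa> / 2}
    \<ge> 1 - (2 * exp (- (2 * \<kappa>\<^sup>2) * real n) + exp (- \<kappa> * n))"
proof -
  let ?P = "Pi_pmf {..<n} undefined (\<lambda>_. label_pmf \<pi>)"
  let ?S = "{\<sigma>. \<bar>label_count n \<sigma> 0 / n - 4 * \<kappa>\<bar> \<ge> \<kappa>}"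
  let ?E = "{(G, \<sigma>). overlap n 2 (independent_labelling G) \<sigma> > \<kappa> / 2}"
  define g :: "(nat \<times> nat \<Rightarrow> bool) \<Rightarrow> graph"
    where "g X = ({..<n}, {{u, v} | u v. X (u, v)})" for X
  have S: "measure_pmf.prob ?P ?S \<le> 2 * exp (- (2 * \<kappa>\<^sup>2) * real n)"
    using prob_label_count_deviation[of "4 * \<kappa>" n \<kappa>] assms by (simp add: \<pi>_def algebra_simps)
  have "measure_pmf.prob (map_pmf (\<lambda>X. (g X, \<sigma>)) (edge_pmf n M \<sigma>)) (- ?E) \<le> exp (- \<kappa> * n)"
    if \<sigma>: "\<sigma> \<in> set_pmf ?P" "\<sigma> \<notin> ?S" for \<sigma>
  proof -
    \<comment> \<open>Rounding up serves both uses: \<open>\<kappa> * n \<le> k\<close> for the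
      first moment bound, and any set with more than \<open>\<kappa> * n\<close> vertices contains a
      \<open>k\<close>-subset.\<close>
    define k where "k = nat \<lceil>\<kappa> * n\<rceil>"
    define B where "B = {X. \<exists>S. S \<subseteq> {v. v < n \<and> \<sigma> v = 1} \<and> card S = k \<and>
                   (\<forall>u\<in>S. \<forall>v\<in>S. u < v \<longrightarrow> \<not> X (u, v))}"
    have "0 \<le> 4 * \<kappa>" "4 * \<kappa> \<le> 1"
      using assms by auto
    then have \<sigma>2: "\<sigma> v < 2" if "v < n" for v
      using \<sigma>(1) label_pmf_two(2)[of "4 * \<kappa>"] that
      by (fastforce simp: set_Pi_pmf PiE_dflt_def \<pi>_def)
    have good: "overlap n 2 (independent_labelling (g X)) \<sigma> > \<kappa> / 2"
      if X: "X \<in> set_pmf (edge_pmf n M \<sigma>)" "X \<notin> B" for X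
    proof (rule overlap_independent_labelling)
      \<comment> \<open>An edge inside class 0 would be a success of a Bernoulli variable with
        parameter 0. Thus the planted set is independent for every \<open>X\<close> in the
        support.\<close>
      have edge: "u < v \<and> v < n \<and> \<not> (\<sigma> u = 0 \<and> \<sigma> v = 0)" if "X (u, v)" for u v
      proof -
        have "(u, v) \<in> {(u, v). u < v \<and> v < n}"
          using X(1) that by (auto simp: edge_pmf_def set_Pi_pmf finite_vertex_pairs PiE_dflt_def)
        moreover from this have "X (u, v) \<in> set_pmf (bernoulli_pmf (M $$ (\<sigma> u, \<sigma> v) / n))"
          using X(1) by (auto simp: edge_pmf_def set_Pi_pmf finite_vertex_pairs PiE_dflt_def)
        then have "M $$ (\<sigma> u, \<sigma> v) \<noteq> 0"
          using that by (auto simp: set_pmf_iff)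
        ultimately show ?thesis
          using assms(6) by (cases "\<sigma> u = 0"; cases "\<sigma> v = 0") auto
      qed
      show "independent_set (g X) {v. v < n \<and> \<sigma> v = 0}"
        using edge by (fastforce simp: independent_set_def g_def doubleton_eq_iff)
      show "real (card (S \<inter> {v. \<sigma> v = 1})) \<le> \<kappa> * n" if S: "independent_set (g X) S" for S
      proof (rule ccontr)
        assume "\<not> real (card (S \<inter> {v. \<sigma> v = 1})) \<le> \<kappa> * n"
        then have "k \<le> card (S \<inter> {v. \<sigma> v = 1})"
          unfolding k_def by linarith
        then obtain S' where S': "S' \<subseteq> S \<inter> {v. \<sigma> v = 1}" "card S' = k"
          by (meson obtain_subset_with_card_n)
        have "\<not> X (u, v)" if "u \<in> S'" "v \<in> S'" "u < v" for u v
        proof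
          assume "X (u, v)"
          then have "{u, v} \<in> snd (g X)"
            by (auto simp: g_def)
          moreover have "u \<in> S" "v \<in> S" "u \<noteq> v"
            using S' that by auto
          ultimately show False
            using S unfolding independent_set_def by blast
        qed
        moreover have "S' \<subseteq> {v. v < n \<and> \<sigma> v = 1}"
          using S S' by (auto simp: independent_set_def g_def)
        ultimately show False
          using X(2) S' unfolding B_def by blast
      qed
      show "3 * \<kappa> < label_count n \<sigma> 0 / n" "label_count n \<sigma> 0 / n < 5 * \<kappa>"
        using \<sigma>(2) by (auto simp: not_le)
    qed (use assms \<sigma>2 in \<open>auto simp: g_def\<close>)
    have "measure_pmf.prob (edge_pmf n M \<sigma>) ((\<lambda>X. (g X, \<sigma>)) -` (- ?E))
        \<le> measure_pmf.prob (edge_pmf n M \<sigma>) B"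
    proof (intro measure_pmf.finite_measure_mono_AE AE_pmfI impI)
      fix X assume "X \<in> set_pmf (edge_pmf n M \<sigma>)" "X \<in> (\<lambda>X. (g X, \<sigma>)) -` (- ?E)"
      then show "X \<in> B"
        using good[of X] by auto
    qed auto
    also have "\<dots> \<le> real (n choose k) * (1 - c / n) ^ (k choose 2)"
      unfolding c_def B_def using assms by (intro prob_class_independent_le) (auto simp: c_def)
    also have "\<dots> \<le> exp (- \<kappa> * n)"
      using assms by (intro choose_mult_power_choose_2_le) (auto simp: k_def)
    finally show ?thesis
      by simp
  qed
  then have "measure_pmf.prob (sbm n M \<pi>) (- ?E) \<le> 2 * exp (- (2 * \<kappa>\<^sup>2) * real n) + exp (- \<kappa> * n)"
    unfolding sbm_def edge_pmf_def[symmetric] g_def[symmetric]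
    by (intro prob_bind_pmf_le[OF S]) auto
  then show ?thesis
    using measure_pmf.prob_compl[of ?E "sbm n M \<pi>"] by (simp add: Compl_eq_Diff_UNIV)
qed

text \<open>The failure bound decays exponentially in \<open>n\<close>, so the limit required by
  \<open>reconstructable\<close> exists and equals 1.\<close>

lemma reconstructable_planted_independent_set:
  fixes \<kappa> :: real and M :: "real mat"
  assumes "0 < \<kappa>" "5 * \<kappa> \<le> 1 / 2" "M $$ (0, 0) = 0" "0 \<le> M $$ (1, 1)"
    and "M $$ (1, 1) * \<kappa> / 2 \<ge> 5 / 2 - ln \<kappa>"
  shows "reconstructable M (vec_of_list [4 * \<kappa>, 1 - 4 * \<kappa>])"
proof -
  let ?\<pi> = "vec_of_list [4 * \<kappa>, 1 - 4 * \<kappa>]"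
  let ?f = "\<lambda>n. measure_pmf.prob (sbm n M ?\<pi>)
    {(G, \<sigma>). overlap n 2 (independent_labelling G) \<sigma> > \<kappa> / 2}"
  have "?f \<longlonglongrightarrow> 1"
  proof (rule tendsto_sandwich[where h = "\<lambda>_. 1"])
    \<comment> \<open>The estimate needs \<open>n > 0\<close> and
      \<open>M $$ (1, 1) \<le> n\<close>, so it holds only from some \<open>n\<close> on.\<close>
    show "eventually (\<lambda>n. 1 - (2 * exp (- (2 * \<kappa>\<^sup>2) * real n) + exp (- \<kappa> * real n)) \<le> ?f n) sequentially"
      using eventually_gt_at_top[of 0] eventually_ge_at_top[of "nat \<lceil>M $$ (1, 1)\<rceil>"]
    proof eventually_elim
      case (elim n)
      then show ?case
        using assms by (intro prob_overlap_independent_labelling) linarith+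
    qed
    have lim: "(\<lambda>n. exp (- x * real n)) \<longlonglongrightarrow> 0" if "x > 0" for x
      using that by real_asymp
    show "(\<lambda>n. 1 - (2 * exp (- (2 * \<kappa>\<^sup>2) * real n) + exp (- \<kappa> * real n))) \<longlonglongrightarrow> 1"
    proof (rule tendsto_eq_rhs)
      show "(\<lambda>n. 1 - (2 * exp (- (2 * \<kappa>\<^sup>2) * real n) + exp (- \<kappa> * real n)))
          \<longlonglongrightarrow> 1 - (2 * 0 + 0)"
        by (intro tendsto_diff tendsto_add tendsto_mult tendsto_const lim) (use assms(1) in auto)
    qed simp
  qed auto
  then have lim: "\<exists>L>0. ?f \<longlonglongrightarrow> L"
    by (intro exI[of _ "1 :: real"] conjI) simp_all
  have dim: "dim_vec ?\<pi> = 2"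
    by simp
  show ?thesis
    unfolding reconstructable_def dim
  proof (rule exI[of _ "\<kappa> / 2"], rule conjI)
    show "\<exists>A. (\<forall>n. \<forall>G\<in>graphs_on n. A G \<in> {..<n} \<rightarrow> {..<2}) \<and>
        (\<exists>L>0. (\<lambda>n. measure_pmf.prob (sbm n M ?\<pi>)
          {(G, \<sigma>). overlap n 2 (A G) \<sigma> > \<kappa> / 2}) \<longlonglongrightarrow> L)"
      using lim by (intro exI[of _ independent_labelling] conjI) (simp_all add: independent_labelling_def)
  qed (use assms(1) in simp)
qed

section \<open>Characteristic polynomials of two by two matrices\<close>

lemma det_mat_2:
  fixes A :: "'a :: comm_ring_1 mat"
  assumes "A \<in> carrier_mat 2 2"
  shows "det A = A $$ (0, 0) * A $$ (1, 1) - A $$ (0, 1) * A $$ (1, 0)"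
proof -
  have "mat_delete A i j \<in> carrier_mat 1 1" for i j
    using mat_delete_carrier[of A 2 2] assms by simp
  then have "det A = (\<Sum>i<2. A $$ (i, 0) * ((- 1) ^ i * mat_delete A i 0 $$ (0, 0)))"
    using laplace_expansion_column[OF assms, of 0] by (simp add: cofactor_def det_single)
  then show ?thesis
    using assms by (simp add: mat_delete_def numeral_2_eq_2 algebra_simps)
qed

lemma char_poly_mat_2:
  fixes A :: "'a :: comm_ring_1 mat"
  assumes "A \<in> carrier_mat 2 2"
  shows "char_poly A = [:A $$ (0, 0) * A $$ (1, 1) - A $$ (0, 1) * A $$ (1, 0),
    - (A $$ (0, 0) + A $$ (1, 1)), 1:]"
proof -
  have "char_poly_matrix A \<in> carrier_mat 2 2"
    using assms by simp
  from det_mat_2[OF this] show ?thesis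
    using assms by (simp add: char_poly_def char_poly_matrix_def)
qed

theorem proposition3p3:
  fixes \<epsilon> :: real
  assumes "\<epsilon> > 0"
  shows "\<exists>(p :: real) (M :: real mat) (\<pi> :: real vec) (d :: real) (l2 :: real).
           \<pi> = vec_of_list [p, 1 - p] \<and> p \<noteq> 1 / 2 \<and> sbm_params M \<pi> \<and>
           d > 0 \<and> (\<forall>i<2. (\<Sum>j<2. M $$ (i, j) * \<pi> $ j) = d) \<and>
           second_eigenvalue (transition_mat d M \<pi>) l2 \<and>
           d * l2\<^sup>2 < \<epsilon> \<and>
           reconstructable M \<pi>"
proof -
  \<comment> \<open>The density term grows like \<open>1 / (2 * t)\<close>, which beats
    \<open>- ln (t\<^sup>2)\<close>; the last quantity behaves like \<open>16 * t\<close>.\<close>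
  have "eventually (\<lambda>t :: real. 0 < t \<and> 5 * t\<^sup>2 \<le> 1 / 2 \<and>
      (1 - 8 * t\<^sup>2) / (t ^ 3 * (1 - 4 * t\<^sup>2)\<^sup>2) * t\<^sup>2 / 2 \<ge> 5 / 2 - ln (t\<^sup>2) \<and>
      1 / t ^ 3 * (4 * t\<^sup>2 / (1 - 4 * t\<^sup>2))\<^sup>2 < \<epsilon>) (at_right 0)"
  proof (intro eventually_conj)
    have "((\<lambda>t :: real. 1 / t ^ 3 * (4 * t\<^sup>2 / (1 - 4 * t\<^sup>2))\<^sup>2) \<longlongrightarrow> 0) (at_right 0)"
      by real_asymp
    then show "eventually (\<lambda>t :: real. 1 / t ^ 3 * (4 * t\<^sup>2 / (1 - 4 * t\<^sup>2))\<^sup>2 < \<epsilon>) (at_right 0)"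
      using assms by (rule order_tendstoD)
  qed real_asymp+
  then obtain t :: real where t: "0 < t" "5 * t\<^sup>2 \<le> 1 / 2"
      "(1 - 8 * t\<^sup>2) / (t ^ 3 * (1 - 4 * t\<^sup>2)\<^sup>2) * t\<^sup>2 / 2 \<ge> 5 / 2 - ln (t\<^sup>2)"
      "1 / t ^ 3 * (4 * t\<^sup>2 / (1 - 4 * t\<^sup>2))\<^sup>2 < \<epsilon>"
    using eventually_happens[of _ "at_right (0 :: real)"] by force
  define p where "p = 4 * t\<^sup>2"
  define d where "d = 1 / t ^ 3"
  define \<pi> where "\<pi> = vec_of_list [p, 1 - p]"
  \<comment> \<open>Row 0 has a zero diagonal entry, so weighted row sum \<open>d\<close> forces the
    off-diagonal entry \<open>d / (1 - p)\<close>; row 1 then forces \<open>c\<close>, which is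
    nonnegative because \<open>p < 1 / 2\<close>.\<close>
  define c where "c = d * (1 - 2 * p) / (1 - p)\<^sup>2"
  define M where "M = mat_of_rows_list 2 [[0, d / (1 - p)], [d / (1 - p), c]]"
  \<comment> \<open>One eigenvalue of \<open>T\<close> is 1, so the other is the trace of
    \<open>T\<close> minus 1.\<close>
  define l where "l = - (p / (1 - p))"
  have p: "0 < p" "p < 1 / 2" and d: "d > 0"
    using t by (auto simp: p_def d_def)
  have c: "c \<ge> 0"
    using p d by (simp add: c_def)
  have \<pi>: "dim_vec \<pi> = 2" "\<pi> $ 0 = p" "\<pi> $ Suc 0 = 1 - p"
    by (simp_all add: \<pi>_def)
  have M: "M \<in> carrier_mat 2 2" "M $$ (0, 0) = 0" "M $$ (0, Suc 0) = d / (1 - p)"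
      "M $$ (Suc 0, 0) = d / (1 - p)" "M $$ (Suc 0, Suc 0) = c"
    by (auto simp: M_def mat_of_rows_list_def)
  have less2: "(\<forall>i<2. Q i) \<longleftrightarrow> Q 0 \<and> Q (Suc 0)" for Q :: "nat \<Rightarrow> bool"
    by (auto simp: less_2_cases_iff)
  have sum2: "(\<Sum>j<2. f j) = f 0 + f (Suc 0)" for f :: "nat \<Rightarrow> real"
    by (simp add: numeral_2_eq_2)
  have "transpose_mat M = M"
    using M by (intro eq_matI) (auto simp: less_2_cases_iff)
  then have params: "sbm_params M \<pi>"
    using M p c d by (simp add: sbm_params_def prob_vector_def \<pi> less2 sum2)
  have rows: "\<forall>i<2. (\<Sum>j<2. M $$ (i, j) * \<pi> $ j) = d"
  proof -
    have "d / (1 - p) * p + c * (1 - p) = d"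
      using p by (simp add: c_def power2_eq_square divide_simps) (simp add: algebra_simps)
    then show ?thesis
      using p by (simp add: less2 sum2 M \<pi>)
  qed
  define T where "T = transition_mat d M \<pi>"
  have T: "T \<in> carrier_mat 2 2"
    using mult_carrier_mat[OF mat_diag_dim M(1)] by (simp add: T_def transition_mat_def \<pi>(1))
  have T_entry: "T $$ (i, j) = \<pi> $ i * M $$ (i, j) / d" if "i < 2" "j < 2" for i j
    using that M by (simp add: T_def transition_mat_def \<pi> mat_diag_mult_left[of M 2 2])
  have entries: "T $$ (0, 0) = 0" "T $$ (0, Suc 0) = - l" "T $$ (Suc 0, 0) = 1"
    using p d by (simp_all add: T_entry M \<pi> l_def)
  have "T $$ (Suc 0, Suc 0) = (1 - 2 * p) / (1 - p)"
    using p d by (simp add: T_entry M \<pi> c_def power2_eq_square)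
  also have "\<dots> = 1 + l"
    using p by (simp add: l_def field_simps)
  finally have "T $$ (Suc 0, Suc 0) = 1 + l" .
  note entries = entries this
  have "second_eigenvalue T l"
    unfolding second_eigenvalue_def
  proof (intro exI[of _ "[]"] conjI)
    \<comment> \<open>Trace \<open>1 + l\<close> and determinant \<open>l\<close> give the roots 1
      and \<open>l\<close>.\<close>
    show "char_poly T = (\<Prod>a\<leftarrow>[1, l]. [:- a, 1:])"
      using char_poly_mat_2[OF T] by (simp add: entries)
    show "\<bar>l\<bar> \<le> 1"
      using p by (simp add: l_def)
  qed auto
  moreover have "d * l\<^sup>2 < \<epsilon>"
    using t(4) by (simp add: d_def l_def p_def)
  moreover have "reconstructable M \<pi>"
  proof -
    have "5 / 2 - ln (t\<^sup>2) \<le> M $$ (Suc 0, Suc 0) * t\<^sup>2 / 2"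
      using t(3) by (simp add: M c_def d_def p_def)
    then show ?thesis
      using reconstructable_planted_independent_set[of "t\<^sup>2" M] t M c
      by (simp add: \<pi>_def p_def)
  qed
  ultimately show ?thesis
    using p d params rows by (intro exI[of _ p] exI[of _ M] exI[of _ \<pi>] exI[of _ d] exI[of _ l])
      (simp add: \<pi>_def T_def)
qed

end
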